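(* Let $A\in\mathbb{Q}^{d\times n}$ have rank $d$, let $b\in\mathbb{R}^n$, let $\omega \in \Omega_{A,b}^+$, and let $x^* \in \mathcal{L}_{A,b}^+$ be the unique minimizer of the optimization problem $$\text{minimize}\quad -\frac{\pi}{2} b^t x - \sum_{j=1}^n \Big(x_j \arccos(x_j) - \sqrt{1-x_j^2}\Big)\quad \text{subject to}\quad Ax = \omega \ \text{ and }\ x \in (-1,1)^n.$$ The unique solution $\theta^*$ of the linear equations $A^t\theta^* = \arccos(x^* ) + \frac{\pi}{2}b$ is a linearly stable steady state solution of the dynamical system $$\dot\theta = A\,\phi_{A,b}(\theta) - \omega .$$
   Context: Let $\operatorname{Row}(A)\subseteq\mathbb{C}^n$ be the $\mathbb{C}$-span of the rows of $A$ and $L_{A,b} = \operatorname{Row}(A)-\frac{\pi}{2}b$. With $\cos$ the coordinate-wise cosine, $\mathcal{L}_{A,b}^+ = \cos(L_{A,b}\cap(0,\pi)^n)\subset(-1,1)^n$ and $\Omega_{A,b}^+ = \{Ax : x\in\mathcal{L}_{A,b}^+\}\subset\mathbb{R}^d$. (For $\omega\in\Omega_{A,b}^+$ the optimization problem has a unique minimizer, and it lies in $\mathcal{L}_{A,b}^+$.) Here $\arccos$ is applied coordinate-wise, with values in $(0,\pi)$. With $a_1,\dots,a_n$ the columns of $A$, the map $\phi_{A,b}:\mathbb{R}^d\to[-1,1]^n$ is $\phi_{A,b}(\theta) = (\cos(a_1\cdot\theta - b_1\frac{\pi}{2}),\dots,\cos(a_n\cdot\theta - b_n\frac{\pi}{2}))$.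 A steady state is a solution $\theta$ of $A\phi_{A,b}(\theta)-\omega = 0$. A steady state $\theta^*$ is called linearly stable if all eigenvalues of the $d\times d$ Jacobian matrix of $\theta\mapsto A\phi_{A,b}(\theta)-\omega$ at $\theta^*$ are negative. *)

theory Defs
  imports "HOL-Analysis.Analysis"
begin

abbreviation real_matrix :: "rat^'n^'d \<Rightarrow> real^'n^'d" where
  "real_matrix A \<equiv> map_matrix real_of_rat A"

definition Row :: "rat^'n^'d \<Rightarrow> (complex^'n) set" where
  "Row A = vec.span (rows (map_matrix of_rat A :: complex^'n^'d))"

definition L_space :: "rat^'n^'d \<Rightarrow> real^'n \<Rightarrow> (complex^'n) set" where
  "L_space A b = {v - (\<chi> j. of_real (pi / 2 * b $ j)) | v. v \<in> Row A}"

text \<open>The points of the complex affine space lying in the open cube \<open>(0,\<pi>)\<^sup>n\<close> are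
  real; they are represented here as real vectors.\<close>

definition L_plus :: "rat^'n^'d \<Rightarrow> real^'n \<Rightarrow> (real^'n) set" where
  "L_plus A b = {(\<chi> j. cos (y $ j)) | y.
     (\<forall>j. 0 < y $ j \<and> y $ j < pi) \<and> (\<chi> j. complex_of_real (y $ j)) \<in> L_space A b}"

definition Omega_plus :: "rat^'n^'d \<Rightarrow> real^'n \<Rightarrow> (real^'d) set" where
  "Omega_plus A b = {real_matrix A *v x | x. x \<in> L_plus A b}"

definition objective :: "real^'n \<Rightarrow> real^'n \<Rightarrow> real" where
  "objective b x =
     - (pi / 2) * (b \<bullet> x) - (\<Sum>j\<in>UNIV. (x $ j * arccos (x $ j) - sqrt (1 - (x $ j)\<^sup>2)))"

definition feasible :: "rat^'n^'d \<Rightarrow> real^'d \<Rightarrow> real^'n \<Rightarrow> bool" where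
  "feasible A \<omega> x \<longleftrightarrow> real_matrix A *v x = \<omega> \<and> (\<forall>j. -1 < x $ j \<and> x $ j < 1)"

definition phi :: "rat^'n^'d \<Rightarrow> real^'n \<Rightarrow> real^'d \<Rightarrow> real^'n" where
  "phi A b \<theta> = (\<chi> j. cos (column j (real_matrix A) \<bullet> \<theta> - b $ j * (pi / 2)))"

definition vector_field :: "rat^'n^'d \<Rightarrow> real^'n \<Rightarrow> real^'d \<Rightarrow> real^'d \<Rightarrow> real^'d" where
  "vector_field A b \<omega> \<theta> = real_matrix A *v phi A b \<theta> - \<omega>"

definition steady_state :: "(real^'d \<Rightarrow> real^'d) \<Rightarrow> real^'d \<Rightarrow> bool" where
  "steady_state F \<theta> \<longleftrightarrow> F \<theta> = 0"

text \<open>Eigenvalues of a real matrix are taken in \<open>\<complex>\<close>, so ``all eigenvalues are negative''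
  includes the assertion that they are all real.\<close>

definition eigenvalue :: "real^'d^'d \<Rightarrow> complex \<Rightarrow> bool" where
  "eigenvalue M c \<longleftrightarrow>
     (\<exists>v :: complex^'d. v \<noteq> 0 \<and> map_matrix complex_of_real M *v v = c *s v)"

definition linearly_stable :: "(real^'d \<Rightarrow> real^'d) \<Rightarrow> real^'d \<Rightarrow> bool" where
  "linearly_stable F \<theta> \<longleftrightarrow>
     steady_state F \<theta> \<and> F differentiable (at \<theta>) \<and>
     (\<forall>c. eigenvalue (jacobian F (at \<theta>)) c \<longrightarrow> c \<in> \<real> \<and> Re c < 0)"

end

theory Submission
  imports Defs
begin

text \<open>
  Since \<open>x\<close> is the cosine of a point of \<open>L_space A b\<close> in the open cube, taking real parts of the
  coefficients of that point gives a solution \<open>\<theta>\<close> of the linear system; it is unique because \<open>A\<close> has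
  full row rank. At \<open>\<theta>\<close> the phases are \<open>arccos (x $ j)\<close>, so \<open>\<theta>\<close> is steady, and the Jacobian is
  \<open>- A S A\<^sup>t\<close> with \<open>S\<close> the diagonal matrix of the sines of these phases, which are positive. The
  Jacobian is therefore symmetric negative definite, so its eigenvalues are negative.
\<close>

lemma map_matrix_of_rat_mult:
  fixes A :: "rat^'n^'d" and B :: "rat^'m^'n"
  shows "map_matrix (of_rat :: rat \<Rightarrow> 'a::field_char_0) (A ** B)
    = map_matrix of_rat A ** map_matrix of_rat B"
  by (simp add: vec_eq_iff map_matrix_def matrix_matrix_mult_def of_rat_sum of_rat_mult)

lemma map_matrix_of_rat_mat_1: "map_matrix (of_rat :: rat \<Rightarrow> 'a::field_char_0) (mat 1) = mat 1"
  by (simp add: vec_eq_iff map_matrix_def mat_def)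

text \<open>The criterion for a right inverse concerns the family of rows indexed by
  \<open>'d\<close>, whereas rank is the dimension of the set \<open>rows A\<close>. Full rank
  bridges the two: it leaves no room for repeated rows.\<close>

lemma right_invertible_full_row_rank:
  fixes A :: "'a::field^'n^'d"
  assumes "rank A = CARD('d)"
  shows "\<exists>B. A ** B = mat 1"
  unfolding matrix_right_invertible_independent_rows
proof (intro allI impI)
  fix c i
  assume sum0: "(\<Sum>i\<in>UNIV. c i *s row i A) = 0"
  have rows: "rows A = range (\<lambda>i. row i A)"
    by (auto simp: rows_def)
  have dim: "vec.dim (rows A) = CARD('d)"
    using assms by (simp add: row_rank_def_gen)
  have fin: "finite (rows A)"
    by (simp add: rows)
  have card: "card (rows A) \<le> CARD('d)"
    unfolding rows by (rule card_image_le) simp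
  \<comment> \<open>A finite set with no more elements than the dimension of its span is
    independent.\<close>
  have ind: "vec.independent (rows A)"
    by (rule vec.card_le_dim_spanning[OF subset_refl vec.span_superset fin]) (simp add: dim card)
  have "CARD('d) \<le> card (rows A)"
    using vec.dim_le_card'[OF fin] dim by simp
  then have inj: "inj (\<lambda>i. row i A)"
    using card unfolding rows by (intro eq_card_imp_inj_on) auto
  \<comment> \<open>Since the rows are distinct, the coefficients can be carried from indices to row
    vectors, where independence of the set applies.\<close>
  define f where "f v = c (the_inv (\<lambda>i. row i A) v)" for v
  have f: "f (row i A) = c i" for i
    using the_inv_f_f[OF inj] by (simp add: f_def)
  have "(\<Sum>v\<in>rows A. f v *s v) = 0"
    using sum0 unfolding rows by (subst sum.reindex[OF inj]) (simp add: f)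
  then have "f (row i A) = 0"
    by (rule vec.independentD[OF ind fin subset_refl]) (simp add: rows)
  then show "c i = 0"
    by (simp add: f)
qed

text \<open>The rank is taken over the rationals, injectivity over the reals. A right inverse
  crosses the field extension, as \<open>of_rat\<close> is a ring homomorphism; transposed, it
  becomes a left inverse.\<close>

lemma transpose_real_matrix_inj:
  fixes A :: "rat^'n^'d"
  assumes "rank A = CARD('d)"
  shows "inj ((*v) (transpose (real_matrix A)))"
proof -
  obtain B :: "rat^'d^'n" where "A ** B = mat 1"
    using right_invertible_full_row_rank[OF assms] ..
  then have "real_matrix A ** real_matrix B = mat 1"
    by (metis map_matrix_of_rat_mult map_matrix_of_rat_mat_1)
  then have "transpose (real_matrix B) ** transpose (real_matrix A) = mat 1"
    by (metis matrix_transpose_mul transpose_mat)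
  then show ?thesis
    using matrix_left_invertible_injective by blast
qed

lemma span_columns_eq_range:
  fixes M :: "'a::field^'n^'m"
  shows "vec.span (columns M) = range ((*v) M)"
proof
  have "column j M = M *v axis j 1" for j
    by (simp add: vec_eq_iff column_def matrix_vector_mult_def axis_def if_distrib cong: if_cong)
  then have "columns M \<subseteq> range ((*v) M)"
    by (auto simp: columns_def)
  moreover have "vec.subspace (range ((*v) M))"
    by (rule vec.subspace_image) (rule vec.subspace_UNIV)
  ultimately show "vec.span (columns M) \<subseteq> range ((*v) M)"
    by (rule vec.span_minimal)
qed (auto simp: matrix_vector_mult_in_columnspace_gen)

lemma Row_eq_range: "Row A = range ((*v) (transpose (map_matrix of_rat A)))"
  unfolding Row_def span_columns_eq_range[symmetric] by (simp del: transpose_matrix_vector)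

text \<open>Membership in \<open>L_space\<close> only provides complex coefficients
  \<open>u\<close>. As \<open>A\<close>, \<open>b\<close> and \<open>y\<close> are real, the real
  parts of \<open>u\<close> satisfy the same equations, and \<open>arccos\<close> recovers
  \<open>y\<close> because its entries lie between 0 and pi.\<close>

lemma L_plus_lift:
  fixes A :: "rat^'n^'d"
  assumes "x \<in> L_plus A b"
  obtains \<theta> where "transpose (real_matrix A) *v \<theta> = (\<chi> j. arccos (x $ j)) + (pi / 2) *\<^sub>R b"
proof -
  obtain y where x: "x = (\<chi> j. cos (y $ j))" and y: "\<forall>j. 0 < y $ j \<and> y $ j < pi"
    and L: "(\<chi> j. complex_of_real (y $ j)) \<in> L_space A b"
    using assms by (auto simp: L_plus_def)
  obtain u where u: "(\<chi> j. complex_of_real (y $ j))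
      = transpose (map_matrix of_rat A) *v u - (\<chi> j. of_real (pi / 2 * b $ j))"
    using L by (auto simp: L_space_def Row_eq_range)
  have "transpose (real_matrix A) *v (\<chi> i. Re (u $ i)) = (\<chi> j. arccos (x $ j)) + (pi / 2) *\<^sub>R b"
  proof (rule vec_eq_iff[THEN iffD2], rule allI)
    fix j
    \<comment> \<open>Exhibits the entries of \<open>A\<close> as real numbers, so that
      \<open>Re\<close> passes through the products.\<close>
    have of_rat: "(of_rat q :: complex) = of_real (of_rat q)" for q
      by (cases q) (simp add: of_rat_rat)
    have "complex_of_real (y $ j)
        = (\<Sum>i\<in>UNIV. of_rat (A $ i $ j) * u $ i) - of_real (pi / 2 * b $ j)"
      using arg_cong[OF u, of "\<lambda>v. v $ j"]
      by (simp add: matrix_vector_mult_def map_matrix_def transpose_def)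
    then have "y $ j = (\<Sum>i\<in>UNIV. of_rat (A $ i $ j) * Re (u $ i)) - pi / 2 * b $ j"
      by (auto simp: of_rat dest!: arg_cong[where f = Re])
    moreover have "arccos (x $ j) = y $ j"
      using y by (simp add: x arccos_cos less_imp_le)
    ultimately show "(transpose (real_matrix A) *v (\<chi> i. Re (u $ i))) $ j
        = ((\<chi> j. arccos (x $ j)) + (pi / 2) *\<^sub>R b) $ j"
      by (simp add: matrix_vector_mult_def map_matrix_def transpose_def)
  qed
  then show thesis ..
qed

text \<open>A Rayleigh quotient argument: pairing the eigenvector equation with the conjugate of
  \<open>v\<close> gives \<open>c * P = - Q\<close> with \<open>P\<close> and \<open>Q\<close> real
  and positive. This yields realness and sign of \<open>c\<close> together, without the spectral
  theorem.\<close>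

lemma eigenvalue_neg_weighted_gram:
  fixes M :: "real^'n^'d" and s :: "'n \<Rightarrow> real"
  assumes s: "\<And>j. s j > 0" and inj: "inj ((*v) (transpose M))"
    and ev: "eigenvalue (\<chi> i k. - (\<Sum>j\<in>UNIV. s j * M $ i $ j * M $ k $ j)) c"
  shows "c \<in> \<real> \<and> Re c < 0"
proof -
  obtain v where v: "v \<noteq> 0" and eq: "map_matrix complex_of_real
      (\<chi> i k. - (\<Sum>j\<in>UNIV. s j * M $ i $ j * M $ k $ j)) *v v = c *s v"
    using ev by (auto simp: eigenvalue_def)
  \<comment> \<open>This is the transpose of \<open>M\<close> applied to the complex vector
    \<open>v\<close>.\<close>
  define w where "w j = (\<Sum>k\<in>UNIV. of_real (M $ k $ j) * v $ k)" for j
  define P where "P = (\<Sum>i\<in>UNIV. (cmod (v $ i))\<^sup>2)"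
  define Q where "Q = (\<Sum>j\<in>UNIV. s j * (cmod (w j))\<^sup>2)"
  have row: "- (\<Sum>j\<in>UNIV. of_real (s j * M $ i $ j) * w j) = c * v $ i" for i
  proof -
    have "c * v $ i = (\<Sum>k\<in>UNIV. of_real (- (\<Sum>j\<in>UNIV. s j * M $ i $ j * M $ k $ j)) * v $ k)"
      using arg_cong[OF eq, of "\<lambda>u. u $ i"] by (simp add: matrix_vector_mult_def map_matrix_def)
    also have "\<dots> = - (\<Sum>k\<in>UNIV. \<Sum>j\<in>UNIV. of_real (s j * M $ i $ j) * (of_real (M $ k $ j) * v $ k))"
      by (simp add: sum_distrib_right sum_negf mult.assoc)
    also have "\<dots> = - (\<Sum>j\<in>UNIV. of_real (s j * M $ i $ j) * w j)"
      unfolding w_def sum_distrib_left by (subst sum.swap) simp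
    finally show ?thesis by simp
  qed
  have "c * of_real P = (\<Sum>i\<in>UNIV. cnj (v $ i) * (c * v $ i))"
    unfolding P_def of_real_sum sum_distrib_left
    by (rule sum.cong) (simp_all only: complex_norm_square mult_ac)
  also have "\<dots> = - (\<Sum>i\<in>UNIV. \<Sum>j\<in>UNIV. cnj (v $ i) * (of_real (s j * M $ i $ j) * w j))"
    by (simp add: row[symmetric] sum_distrib_left sum_negf)
  \<comment> \<open>As \<open>M\<close> is real, summing over \<open>i\<close> first assembles the
    conjugates of the \<open>v $ i\<close> into \<open>cnj (w j)\<close>.\<close>
  also have "\<dots> = - (\<Sum>j\<in>UNIV. of_real (s j) * w j * cnj (w j))"
    by (subst sum.swap) (simp add: w_def[THEN arg_cong[where f = cnj]] sum_distrib_left mult_ac)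
  also have "\<dots> = - of_real Q"
    unfolding Q_def of_real_sum by (simp add: complex_norm_square mult_ac del: of_real_power)
  finally have cPQ: "c * of_real P = - of_real Q" .
  obtain i where "v $ i \<noteq> 0"
    using v by (auto simp: vec_eq_iff)
  then have P: "P > 0"
    unfolding P_def by (intro sum_pos2[of _ i]) auto
  \<comment> \<open>Injectivity is given over the reals only, so it is applied to the real and
    imaginary parts of \<open>v\<close> separately.\<close>
  have "\<exists>j. w j \<noteq> 0"
  proof (rule ccontr)
    assume "\<not> ?thesis"
    then have w0: "w j = 0" for j by simp
    have "transpose M *v (\<chi> i. Re (v $ i)) = transpose M *v 0"
      using w0[THEN arg_cong[where f = Re]]
      by (simp add: vec_eq_iff matrix_vector_mult_def transpose_def w_def)
    moreover have "transpose M *v (\<chi> i. Im (v $ i)) = transpose M *v 0"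
      using w0[THEN arg_cong[where f = Im]]
      by (simp add: vec_eq_iff matrix_vector_mult_def transpose_def w_def)
    ultimately have "(\<chi> i. Re (v $ i)) = 0" "(\<chi> i. Im (v $ i)) = 0"
      using injD[OF inj] by blast+
    then show False
      using v by (simp add: vec_eq_iff complex_eq_iff)
  qed
  then obtain j where "w j \<noteq> 0" ..
  then have Q: "Q > 0"
    unfolding Q_def using s by (intro sum_pos2[of _ j]) (auto simp: less_imp_le)
  have "c = of_real (- Q / P)"
    using cPQ P by (simp add: field_simps)
  then show ?thesis
    using P Q by simp
qed

text \<open>The chain rule brings in each column of \<open>A\<close> a second time, through the
  phase, and the derivative of cosine brings the minus sign. The matrix is written in the form that
  \<open>eigenvalue_neg_weighted_gram\<close> expects.\<close>

lemma vector_field_has_derivative: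
  fixes A :: "rat^'n^'d"
  shows "(vector_field A b \<omega> has_derivative
    (*v) (\<chi> i k. - (\<Sum>j\<in>UNIV. sin (column j (real_matrix A) \<bullet> \<theta> - b $ j * (pi / 2))
      * real_matrix A $ i $ j * real_matrix A $ k $ j))) (at \<theta>)"
proof -
  let ?M = "real_matrix A"
  let ?s = "\<lambda>j. sin (column j ?M \<bullet> \<theta> - b $ j * (pi / 2))"
  have "((\<lambda>\<theta>. vector_field A b \<omega> \<theta> $ i) has_derivative
     (\<lambda>h. ((\<chi> i k. - (\<Sum>j\<in>UNIV. ?s j * ?M $ i $ j * ?M $ k $ j)) *v h) $ i)) (at \<theta>)" for i
  proof -
    have "((\<lambda>\<theta>. (\<Sum>j\<in>UNIV. ?M $ i $ j * cos (column j ?M \<bullet> \<theta> - b $ j * (pi / 2))) - \<omega> $ i)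
      has_derivative (\<lambda>h. \<Sum>j\<in>UNIV. ?M $ i $ j * (- ?s j * (column j ?M \<bullet> h)))) (at \<theta>)"
      by (auto intro!: derivative_eq_intros simp: fun_eq_iff mult_ac)
    moreover have "(\<Sum>j\<in>UNIV. ?M $ i $ j * (- ?s j * (column j ?M \<bullet> h)))
      = ((\<chi> i k. - (\<Sum>j\<in>UNIV. ?s j * ?M $ i $ j * ?M $ k $ j)) *v h) $ i" for h
    proof -
      have "(\<Sum>j\<in>UNIV. ?M $ i $ j * (- ?s j * (column j ?M \<bullet> h)))
        = - (\<Sum>j\<in>UNIV. \<Sum>k\<in>UNIV. ?s j * ?M $ i $ j * ?M $ k $ j * h $ k)"
        by (simp add: inner_vec_def column_def sum_distrib_left sum_distrib_right sum_negf mult_ac)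
      also have "\<dots> = - (\<Sum>k\<in>UNIV. \<Sum>j\<in>UNIV. ?s j * ?M $ i $ j * ?M $ k $ j * h $ k)"
        by (subst sum.swap) simp
      finally show ?thesis
        by (simp add: matrix_vector_mult_def sum_distrib_right sum_negf)
    qed
    ultimately show ?thesis
      by (simp add: vector_field_def phi_def matrix_vector_mult_def)
  qed
  then show ?thesis
    by (subst has_derivative_componentwise_within) (auto simp: Basis_vec_def inner_axis)
qed

theorem proposition5p4:
  fixes A :: "rat^'n^'d" and b :: "real^'n" and \<omega> :: "real^'d" and x :: "real^'n"
  assumes "rank A = CARD('d)"
    and "\<omega> \<in> Omega_plus A b"
    and "x \<in> L_plus A b"
    and "is_arg_min (objective b) (feasible A \<omega>) x"
    and "\<forall>y. is_arg_min (objective b) (feasible A \<omega>) y \<longrightarrow> y = x"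
  shows "(\<exists>!\<theta>. transpose (real_matrix A) *v \<theta> = (\<chi> j. arccos (x $ j)) + (pi / 2) *\<^sub>R b) \<and>
    (\<forall>\<theta>. transpose (real_matrix A) *v \<theta> = (\<chi> j. arccos (x $ j)) + (pi / 2) *\<^sub>R b \<longrightarrow>
           steady_state (vector_field A b \<omega>) \<theta> \<and> linearly_stable (vector_field A b \<omega>) \<theta>)"
proof (intro conjI allI impI)
  note inj = transpose_real_matrix_inj[OF assms(1)]
  show "\<exists>!\<theta>. transpose (real_matrix A) *v \<theta> = (\<chi> j. arccos (x $ j)) + (pi / 2) *\<^sub>R b"
    using L_plus_lift[OF assms(3)] inj by (metis injD)
  fix \<theta>
  assume \<theta>: "transpose (real_matrix A) *v \<theta> = (\<chi> j. arccos (x $ j)) + (pi / 2) *\<^sub>R b"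
  let ?s = "\<lambda>j. sin (column j (real_matrix A) \<bullet> \<theta> - b $ j * (pi / 2))"
  let ?J = "\<chi> i k. - (\<Sum>j\<in>UNIV. ?s j * real_matrix A $ i $ j * real_matrix A $ k $ j)"
  have Ax: "real_matrix A *v x = \<omega>" and x: "- 1 < x $ j" "x $ j < 1" for j
    using assms(4) by (auto simp: is_arg_min_def feasible_def)
  \<comment> \<open>The linear system read coordinate by coordinate; both the steady state equation
    and the signs of the sines follow from it.\<close>
  have phase: "column j (real_matrix A) \<bullet> \<theta> - b $ j * (pi / 2) = arccos (x $ j)" for j
    using arg_cong[OF \<theta>, of "\<lambda>v. v $ j"]
    by (simp add: matrix_vector_mult_def transpose_def column_def inner_vec_def mult_ac)
  have "phi A b \<theta> = x"
    unfolding phi_def phase using x by (simp add: vec_eq_iff less_imp_le)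
  then show steady: "steady_state (vector_field A b \<omega>) \<theta>"
    by (simp add: steady_state_def vector_field_def Ax)
  \<comment> \<open>The strict bounds on \<open>x $ j\<close> keep \<open>arccos (x $ j)\<close>
    away from 0 and pi, where the sine would vanish.\<close>
  have s: "?s j > 0" for j
    unfolding phase using x[of j] arccos_lt_bounded[of "x $ j"] by (intro sin_gt_zero) auto
  have J: "jacobian (vector_field A b \<omega>) (at \<theta>) = ?J"
    unfolding jacobian_def frechet_derivative_at[OF vector_field_has_derivative, symmetric]
    by (rule matrix_of_matrix_vector_mul)
  show "linearly_stable (vector_field A b \<omega>) \<theta>"
    unfolding linearly_stable_def J differentiable_def
    by (intro conjI allI impI steady exI[of _ "(*v) ?J"] vector_field_has_derivative)
      (use eigenvalue_neg_weighted_gram[of ?s, OF s inj] in blast)+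
qed

end
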